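(* Let $(X,d)$ be a premetric space. Then (i) there exists an isometry $\varphi:(\widehat{X}_R,\widehat{d}_R)\to(\widehat{X},\widehat{d})$; and (ii) the natural map $\widehat{i}_R:\widehat{X}_R\to\widehat{\widehat{X}}_R$ is onto, i.e. $(\widehat{X}_R,\widehat{d}_R)$ is R-complete.
   Context: A premetric on a nonempty set $X$ is a relation $d$ between $X\times X$ and the nonnegative rationals, written $d(x,y)\leq q$, such that for all $x,y,z\in X$ and nonnegative rationals $p,q$: (1) $d(x,y)\leq 0$ iff $x=y$; (2) $d(x,y)\leq q$ implies $d(y,x)\leq q$; (3) $d(x,z)\leq p$ and $d(z,y)\leq q$ imply $d(x,y)\leq p+q$; (4) $d(x,y)\leq p$ iff $d(x,y)\leq q$ for all rationals $q>p$. For $S\subseteq X$, $\operatorname{diam} S\leq q$ means $d(x,y)\leq q$ for all $x,y\in S$. $\mathbb{Q}^+$ denotes the positive rationals. Cauchy-family completion: a Cauchy family on $X$ is $F\subseteq\mathcal{P}(X)$ with (i) $S\cap T\neq\emptyset$ for all $S,T\in F$ and (ii) for every rational $\varepsilon>0$ some $S\in F$ has $\operatorname{diam} S\leq\varepsilon$. For Cauchy families, $d(F,F')\leq q$ means: for every rational $\varepsilon>0$ there exist $S\in F$, $T\in F'$ with $\operatorname{diam} S,\operatorname{diam} T\leq\varepsilon$ and $\operatorname{diam}(S\cup T)\leq q+\varepsilon$. $\widehat{X}$ is the quotient of the Cauchy families by $F\sim F'$ iff $d(F,F')\leq 0$, with premetric $\widehat{d}([F],[F'])\leq q$ iff $d(F,F')\leq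 q$. Richman completion: a family $S=\{S_q:q\in\mathbb{Q}^+\}$ of subsets of $X$ is regular if $d(x,y)\leq p+q$ for all $x\in S_p$, $y\in S_q$. Regular families $S,T$ are equivalent if $d(x,y)\leq p+q$ for all $x\in S_p$, $y\in T_q$. $\widehat{X}_R$ is the set of equivalence classes of regular families, with $\widehat{d}_R([S],[T])\leq q$ iff for every rational $\varepsilon>0$ there are $a,b,c\in\mathbb{Q}^+$, $s\in S_a$, $t\in T_b$ with $a+b+c<q+\varepsilon$ and $d(s,t)\leq c$; this is a premetric. The natural map $i_R:X\to\widehat{X}_R$ sends $x$ to the class of the family with $S_q=\{x\}$ for all $q$. A premetric space $Y$ is R-complete if $i_R:Y\to\widehat{Y}_R$ is onto; $\widehat{\widehat{X}}_R$ denotes the Richman completion of $(\widehat{X}_R,\widehat{d}_R)$ and $\widehat{i}_R$ its natural map. A map $f:(X,d_X)\to(Y,d_Y)$ is an isometric embedding if $d_X(x,x')\leq q\iff d_Y(f(x),f(x'))\leq q$ for all $x,x'$ and nonnegative rationals $q$; an isometry is an onto isometric embedding.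
   Formalization: Regular families are required to consist of nonempty sets S_q; without this the family of empty sets would be regular and equivalent to every regular family, so equivalence would not be transitive and the Richman completion would not be well defined. *)

theory Defs
  imports Complex_Main "HOL-Library.FuncSet"
begin

text \<open>
  A premetric is a relation: \<open>d x y q\<close> reads \<open>d(x,y) \<le> q\<close>. Spaces are given by a carrier set \<open>X\<close>,
  and only the values of \<open>d\<close> at points of \<open>X\<close> and rationals \<open>q \<ge> 0\<close> are meaningful.
\<close>

definition premetric_on :: "'a set \<Rightarrow> ('a \<Rightarrow> 'a \<Rightarrow> rat \<Rightarrow> bool) \<Rightarrow> bool" where
  "premetric_on X d \<longleftrightarrow>
     X \<noteq> {} \<and>
     (\<forall>x\<in>X. \<forall>y\<in>X. d x y 0 \<longleftrightarrow> x = y) \<and>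
     (\<forall>x\<in>X. \<forall>y\<in>X. \<forall>q\<ge>0. d x y q \<longrightarrow> d y x q) \<and>
     (\<forall>x\<in>X. \<forall>y\<in>X. \<forall>z\<in>X. \<forall>p\<ge>0. \<forall>q\<ge>0. d x z p \<and> d z y q \<longrightarrow> d x y (p + q)) \<and>
     (\<forall>x\<in>X. \<forall>y\<in>X. \<forall>p\<ge>0. d x y p \<longleftrightarrow> (\<forall>q>p. d x y q))"

definition diam_le :: "('a \<Rightarrow> 'a \<Rightarrow> rat \<Rightarrow> bool) \<Rightarrow> 'a set \<Rightarrow> rat \<Rightarrow> bool" where
  "diam_le d S q \<longleftrightarrow> (\<forall>x\<in>S. \<forall>y\<in>S. d x y q)"

definition isometric_embedding ::
  "'a set \<Rightarrow> ('a \<Rightarrow> 'a \<Rightarrow> rat \<Rightarrow> bool) \<Rightarrow> 'b set \<Rightarrow> ('b \<Rightarrow> 'b \<Rightarrow> rat \<Rightarrow> bool) \<Rightarrow> ('a \<Rightarrow> 'b) \<Rightarrow> bool" where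
  "isometric_embedding X dX Y dY f \<longleftrightarrow>
     f \<in> X \<rightarrow> Y \<and> (\<forall>x\<in>X. \<forall>x'\<in>X. \<forall>q\<ge>0. dX x x' q \<longleftrightarrow> dY (f x) (f x') q)"

definition premetric_isometry ::
  "'a set \<Rightarrow> ('a \<Rightarrow> 'a \<Rightarrow> rat \<Rightarrow> bool) \<Rightarrow> 'b set \<Rightarrow> ('b \<Rightarrow> 'b \<Rightarrow> rat \<Rightarrow> bool) \<Rightarrow> ('a \<Rightarrow> 'b) \<Rightarrow> bool" where
  "premetric_isometry X dX Y dY f \<longleftrightarrow> isometric_embedding X dX Y dY f \<and> f ` X = Y"


subsection \<open>Completion by Cauchy families\<close>

definition cauchy_families :: "'a set \<Rightarrow> ('a \<Rightarrow> 'a \<Rightarrow> rat \<Rightarrow> bool) \<Rightarrow> 'a set set set" where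
  "cauchy_families X d =
     {F. F \<subseteq> Pow X \<and> (\<forall>S\<in>F. \<forall>T\<in>F. S \<inter> T \<noteq> {}) \<and> (\<forall>\<epsilon>>0. \<exists>S\<in>F. diam_le d S \<epsilon>)}"

definition cauchy_family_dist ::
  "('a \<Rightarrow> 'a \<Rightarrow> rat \<Rightarrow> bool) \<Rightarrow> 'a set set \<Rightarrow> 'a set set \<Rightarrow> rat \<Rightarrow> bool" where
  "cauchy_family_dist d F F' q \<longleftrightarrow>
     (\<forall>\<epsilon>>0. \<exists>S\<in>F. \<exists>T\<in>F'. diam_le d S \<epsilon> \<and> diam_le d T \<epsilon> \<and> diam_le d (S \<union> T) (q + \<epsilon>))"

definition cauchy_rel ::
  "'a set \<Rightarrow> ('a \<Rightarrow> 'a \<Rightarrow> rat \<Rightarrow> bool) \<Rightarrow> ('a set set \<times> 'a set set) set" where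
  "cauchy_rel X d =
     {(F, F'). F \<in> cauchy_families X d \<and> F' \<in> cauchy_families X d \<and> cauchy_family_dist d F F' 0}"

definition cauchy_completion :: "'a set \<Rightarrow> ('a \<Rightarrow> 'a \<Rightarrow> rat \<Rightarrow> bool) \<Rightarrow> 'a set set set set" where
  "cauchy_completion X d = cauchy_families X d // cauchy_rel X d"

text \<open>Independence of the representatives is \<open>cauchy_dist_class\<close> below.\<close>

definition cauchy_dist ::
  "('a \<Rightarrow> 'a \<Rightarrow> rat \<Rightarrow> bool) \<Rightarrow> 'a set set set \<Rightarrow> 'a set set set \<Rightarrow> rat \<Rightarrow> bool" where
  "cauchy_dist d A B q \<longleftrightarrow> (\<exists>F\<in>A. \<exists>F'\<in>B. cauchy_family_dist d F F' q)"


subsection \<open>Richman completion\<close>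

text \<open>
  The members of a regular family are required to be nonempty. Otherwise the family of empty sets
  would be regular and equivalent to every regular family, so that equivalence would not be
  transitive, and it would have no finite distance to itself.
\<close>

definition regular_families :: "'a set \<Rightarrow> ('a \<Rightarrow> 'a \<Rightarrow> rat \<Rightarrow> bool) \<Rightarrow> (rat \<Rightarrow> 'a set) set" where
  "regular_families X d =
     {S \<in> {0<..} \<rightarrow>\<^sub>E Pow X. (\<forall>q>0. S q \<noteq> {}) \<and>
        (\<forall>p>0. \<forall>q>0. \<forall>x\<in>S p. \<forall>y\<in>S q. d x y (p + q))}"

definition regular_rel ::
  "'a set \<Rightarrow> ('a \<Rightarrow> 'a \<Rightarrow> rat \<Rightarrow> bool) \<Rightarrow> ((rat \<Rightarrow> 'a set) \<times> (rat \<Rightarrow> 'a set)) set" where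
  "regular_rel X d =
     {(S, T). S \<in> regular_families X d \<and> T \<in> regular_families X d \<and>
        (\<forall>p>0. \<forall>q>0. \<forall>x\<in>S p. \<forall>y\<in>T q. d x y (p + q))}"

definition regular_family_dist ::
  "('a \<Rightarrow> 'a \<Rightarrow> rat \<Rightarrow> bool) \<Rightarrow> (rat \<Rightarrow> 'a set) \<Rightarrow> (rat \<Rightarrow> 'a set) \<Rightarrow> rat \<Rightarrow> bool" where
  "regular_family_dist d S T q \<longleftrightarrow>
     (\<forall>\<epsilon>>0. \<exists>a>0. \<exists>b>0. \<exists>c>0. \<exists>s\<in>S a. \<exists>t\<in>T b. a + b + c < q + \<epsilon> \<and> d s t c)"

definition richman_completion ::
  "'a set \<Rightarrow> ('a \<Rightarrow> 'a \<Rightarrow> rat \<Rightarrow> bool) \<Rightarrow> (rat \<Rightarrow> 'a set) set set" where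
  "richman_completion X d = regular_families X d // regular_rel X d"

text \<open>Independence of the representatives is \<open>richman_dist_class\<close> below.\<close>

definition richman_dist ::
  "('a \<Rightarrow> 'a \<Rightarrow> rat \<Rightarrow> bool) \<Rightarrow> (rat \<Rightarrow> 'a set) set \<Rightarrow> (rat \<Rightarrow> 'a set) set \<Rightarrow> rat \<Rightarrow> bool" where
  "richman_dist d A B q \<longleftrightarrow> (\<exists>S\<in>A. \<exists>T\<in>B. regular_family_dist d S T q)"

definition richman_map ::
  "'a set \<Rightarrow> ('a \<Rightarrow> 'a \<Rightarrow> rat \<Rightarrow> bool) \<Rightarrow> 'a \<Rightarrow> (rat \<Rightarrow> 'a set) set" where
  "richman_map X d x = regular_rel X d `` {\<lambda>q\<in>{0<..}. {x}}"

definition R_complete :: "'a set \<Rightarrow> ('a \<Rightarrow> 'a \<Rightarrow> rat \<Rightarrow> bool) \<Rightarrow> bool" where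
  "R_complete X d \<longleftrightarrow> richman_map X d ` X = richman_completion X d"


subsection \<open>Both completions are well-defined premetric spaces\<close>

lemma premetric_onD:
  assumes "premetric_on X d"
  shows "X \<noteq> {}"
    and "x \<in> X \<Longrightarrow> y \<in> X \<Longrightarrow> d x y 0 \<longleftrightarrow> x = y"
    and "x \<in> X \<Longrightarrow> y \<in> X \<Longrightarrow> 0 \<le> q \<Longrightarrow> d x y q \<Longrightarrow> d y x q"
    and "x \<in> X \<Longrightarrow> y \<in> X \<Longrightarrow> z \<in> X \<Longrightarrow> 0 \<le> p \<Longrightarrow> 0 \<le> q \<Longrightarrow> d x z p \<Longrightarrow> d z y q \<Longrightarrow> d x y (p + q)"
    and "x \<in> X \<Longrightarrow> y \<in> X \<Longrightarrow> 0 \<le> p \<Longrightarrow> (\<And>q. p < q \<Longrightarrow> d x y q) \<Longrightarrow> d x y p"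
    and "x \<in> X \<Longrightarrow> y \<in> X \<Longrightarrow> 0 \<le> p \<Longrightarrow> p \<le> q \<Longrightarrow> d x y p \<Longrightarrow> d x y q"
proof -
  note D = assms[unfolded premetric_on_def]
  note 1 = D[THEN conjunct1] and 2 = D[THEN conjunct2, THEN conjunct1]
    and 3 = D[THEN conjunct2, THEN conjunct2, THEN conjunct1]
    and 4 = D[THEN conjunct2, THEN conjunct2, THEN conjunct2, THEN conjunct1]
    and 5 = D[THEN conjunct2, THEN conjunct2, THEN conjunct2, THEN conjunct2]
  show "X \<noteq> {}" by (rule 1)
  show "x \<in> X \<Longrightarrow> y \<in> X \<Longrightarrow> d x y 0 \<longleftrightarrow> x = y" using 2 by simp
  show "x \<in> X \<Longrightarrow> y \<in> X \<Longrightarrow> 0 \<le> q \<Longrightarrow> d x y q \<Longrightarrow> d y x q" using 3 by blast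
  show "x \<in> X \<Longrightarrow> y \<in> X \<Longrightarrow> z \<in> X \<Longrightarrow> 0 \<le> p \<Longrightarrow> 0 \<le> q \<Longrightarrow> d x z p \<Longrightarrow> d z y q \<Longrightarrow> d x y (p + q)"
    using 4 by blast
  show "x \<in> X \<Longrightarrow> y \<in> X \<Longrightarrow> 0 \<le> p \<Longrightarrow> (\<And>q. p < q \<Longrightarrow> d x y q) \<Longrightarrow> d x y p" using 5 by blast
  show "d x y q" if "x \<in> X" "y \<in> X" "0 \<le> p" "p \<le> q" "d x y p"
  proof (cases "p = q")
    case False
    then show ?thesis using 5 that by (metis order_le_less)
  qed (use that in simp)
qed

lemma premetric_on_imageI:
  assumes ne: "c ` C \<noteq> {}"
    and zero: "\<And>x y. x \<in> C \<Longrightarrow> y \<in> C \<Longrightarrow> d (c x) (c y) 0 \<longleftrightarrow> c x = c y"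
    and sym: "\<And>x y q. x \<in> C \<Longrightarrow> y \<in> C \<Longrightarrow> 0 \<le> q \<Longrightarrow> d (c x) (c y) q \<Longrightarrow> d (c y) (c x) q"
    and tri: "\<And>x y z p q. x \<in> C \<Longrightarrow> y \<in> C \<Longrightarrow> z \<in> C \<Longrightarrow> 0 \<le> p \<Longrightarrow> 0 \<le> q \<Longrightarrow>
      d (c x) (c z) p \<Longrightarrow> d (c z) (c y) q \<Longrightarrow> d (c x) (c y) (p + q)"
    and lim: "\<And>x y p. x \<in> C \<Longrightarrow> y \<in> C \<Longrightarrow> 0 \<le> p \<Longrightarrow>
      d (c x) (c y) p \<longleftrightarrow> (\<forall>q>p. d (c x) (c y) q)"
  shows "premetric_on (c ` C) d"
  unfolding premetric_on_def
proof (intro conjI)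
  show "\<forall>x\<in>c ` C. \<forall>y\<in>c ` C. d x y 0 \<longleftrightarrow> x = y" using zero by blast
  show "\<forall>x\<in>c ` C. \<forall>y\<in>c ` C. \<forall>q\<ge>0. d x y q \<longrightarrow> d y x q" using sym by blast
  show "\<forall>x\<in>c ` C. \<forall>y\<in>c ` C. \<forall>z\<in>c ` C. \<forall>p\<ge>0. \<forall>q\<ge>0. d x z p \<and> d z y q \<longrightarrow> d x y (p + q)"
    using tri by blast
  show "\<forall>x\<in>c ` C. \<forall>y\<in>c ` C. \<forall>p\<ge>0. d x y p \<longleftrightarrow> (\<forall>q>p. d x y q)" using lim by blast
qed (rule ne)

lemma cauchy_family_dist_iff:
  assumes pm: "premetric_on X d" and F: "F \<in> cauchy_families X d" and G: "G \<in> cauchy_families X d"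
    and q: "0 \<le> q"
  shows "cauchy_family_dist d F G q \<longleftrightarrow>
    (\<forall>p>0. \<forall>r>0. \<forall>S\<in>F. \<forall>T\<in>G. diam_le d S p \<longrightarrow> diam_le d T r \<longrightarrow>
       (\<forall>x\<in>S. \<forall>y\<in>T. d x y (p + q + r)))" (is "?L \<longleftrightarrow> ?R")
proof
  assume L: ?L
  show ?R
  proof (intro allI impI ballI)
    fix p r S T x y
    assume a: "0 < p" "0 < r" "S \<in> F" "T \<in> G" "diam_le d S p" "diam_le d T r" "x \<in> S" "y \<in> T"
    have X: "S \<subseteq> X" "T \<subseteq> X" using F G a by (auto simp: cauchy_families_def)
    show "d x y (p + q + r)"
    proof (rule premetric_onD(5)[OF pm])
      fix k assume k: "p + q + r < k"
      define e where "e = k - (p + q + r)"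
      have e: "0 < e" using k by (simp add: e_def)
      obtain S0 T0 where st: "S0 \<in> F" "T0 \<in> G" "diam_le d (S0 \<union> T0) (q + e)"
        using L e unfolding cauchy_family_dist_def by blast
      have "S \<inter> S0 \<noteq> {}" "T \<inter> T0 \<noteq> {}"
        using F G a(3,4) st(1,2) by (simp_all add: cauchy_families_def)
      then obtain u v where uv: "u \<in> S" "u \<in> S0" "v \<in> T" "v \<in> T0" by blast
      have 1: "d x u p" "d u v (q + e)" "d v y r"
        using a uv st by (auto simp: diam_le_def)
      have "d x v (p + (q + e))"
        by (rule premetric_onD(4)[OF pm _ _ _ _ _ 1(1,2)]) (use a uv X q e in auto)
      from premetric_onD(4)[OF pm _ _ _ _ _ this 1(3)] have "d x y ((p + (q + e)) + r)"
        using a uv X q e by auto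
      then show "d x y k" by (simp add: e_def algebra_simps)
    qed (use a X q in auto)
  qed
next
  assume R: ?R
  show ?L unfolding cauchy_family_dist_def
  proof (intro allI impI)
    fix e :: rat assume e: "0 < e"
    then have e2: "0 < e / 2" by simp
    have "\<exists>S\<in>F. diam_le d S (e/2)" "\<exists>T\<in>G. diam_le d T (e/2)"
      using F G e2 by (simp_all add: cauchy_families_def)
    then obtain S T where st: "S \<in> F" "T \<in> G" "diam_le d S (e/2)" "diam_le d T (e/2)" by blast
    have X: "S \<subseteq> X" "T \<subseteq> X" using F G st by (auto simp: cauchy_families_def)
    have 1: "d x y (q + e)" if "x \<in> S" "y \<in> T" for x y
    proof -
      have "d x y (e/2 + q + e/2)" using R e2 st that by blast
      then show ?thesis by (simp add: algebra_simps)
    qed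
    have 2: "d y x (q + e)" if "x \<in> S" "y \<in> T" for x y
      by (rule premetric_onD(3)[OF pm]) (use 1 that X q e in auto)
    have mono: "d x y (e/2) \<Longrightarrow> e / 2 \<le> k \<Longrightarrow> x \<in> S \<union> T \<Longrightarrow> y \<in> S \<union> T \<Longrightarrow> d x y k" for x y k
      by (rule premetric_onD(6)[OF pm, where p = "e/2"]) (use X e in auto)
    have "diam_le d S e" "diam_le d T e"
      using st mono e by (auto simp: diam_le_def)
    moreover have "diam_le d (S \<union> T) (q + e)"
      unfolding diam_le_def
    proof (intro ballI)
      fix x y assume xy: "x \<in> S \<union> T" "y \<in> S \<union> T"
      have "e / 2 \<le> q + e" using q e by simp
      then show "d x y (q + e)"
        using xy 1 2 st mono unfolding diam_le_def by blast
    qed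
    ultimately show "\<exists>S\<in>F. \<exists>T\<in>G. diam_le d S e \<and> diam_le d T e \<and> diam_le d (S \<union> T) (q + e)"
      using st by blast
  qed
qed

lemma cauchy_family_dist_sym: "cauchy_family_dist d F G q \<Longrightarrow> cauchy_family_dist d G F q"
  unfolding cauchy_family_dist_def by (metis sup_commute)

lemma cauchy_family_dist_refl: "F \<in> cauchy_families X d \<Longrightarrow> cauchy_family_dist d F F 0"
  unfolding cauchy_family_dist_def cauchy_families_def by simp (metis sup.idem)

lemma cauchy_family_dist_trans:
  assumes pm: "premetric_on X d"
    and F: "F \<in> cauchy_families X d" and G: "G \<in> cauchy_families X d" and H: "H \<in> cauchy_families X d"
    and pq: "0 \<le> p" "0 \<le> q"
    and FG: "cauchy_family_dist d F G p" and GH: "cauchy_family_dist d G H q"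
  shows "cauchy_family_dist d F H (p + q)"
  unfolding cauchy_family_dist_iff[OF pm F H add_nonneg_nonneg[OF pq]]
proof (intro allI impI ballI)
  fix a b S T x y
  assume a: "0 < a" "0 < b" "S \<in> F" "T \<in> H" "diam_le d S a" "diam_le d T b" "x \<in> S" "y \<in> T"
  have X: "S \<subseteq> X" "T \<subseteq> X" using F H a by (auto simp: cauchy_families_def)
  show "d x y (a + (p + q) + b)"
  proof (rule premetric_onD(5)[OF pm])
    fix k assume k: "a + (p + q) + b < k"
    define e where "e = (k - (a + (p + q) + b)) / 2"
    have e: "0 < e" using k by (simp add: e_def)
    obtain U where U: "U \<in> G" "diam_le d U e" using G e unfolding cauchy_families_def by blast
    have "U \<subseteq> X" "U \<noteq> {}" using G U(1) by (auto simp: cauchy_families_def)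
    then obtain u where u: "u \<in> U" "u \<in> X" by blast
    have 1: "d x u (a + p + e)"
      using FG a U u e unfolding cauchy_family_dist_iff[OF pm F G pq(1)] by blast
    have 2: "d u y (e + q + b)"
      using GH a U u e unfolding cauchy_family_dist_iff[OF pm G H pq(2)] by blast
    have "d x y ((a + p + e) + (e + q + b))"
      by (rule premetric_onD(4)[OF pm _ _ _ _ _ 1 2]) (use a u X pq e in auto)
    then show "d x y k" by (simp add: e_def field_simps)
  qed (use a X pq in auto)
qed

lemma equiv_cauchy_rel:
  assumes pm: "premetric_on X d"
  shows "equiv (cauchy_families X d) (cauchy_rel X d)"
proof (rule equivI)
  show "cauchy_rel X d \<subseteq> cauchy_families X d \<times> cauchy_families X d"
    by (auto simp: cauchy_rel_def)
  show "refl_on (cauchy_families X d) (cauchy_rel X d)"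
    by (auto simp: refl_on_def cauchy_rel_def intro: cauchy_family_dist_refl)
  show "sym (cauchy_rel X d)"
    by (auto simp: sym_def cauchy_rel_def intro: cauchy_family_dist_sym)
  show "trans (cauchy_rel X d)"
    by (auto simp: trans_def cauchy_rel_def dest: cauchy_family_dist_trans[OF pm, where p = 0 and q = 0])
qed

lemma cauchy_dist_class:
  assumes pm: "premetric_on X d" and F: "F \<in> cauchy_families X d" and G: "G \<in> cauchy_families X d"
    and q: "0 \<le> q"
  shows "cauchy_dist d (cauchy_rel X d `` {F}) (cauchy_rel X d `` {G}) q \<longleftrightarrow> cauchy_family_dist d F G q"
proof
  assume "cauchy_dist d (cauchy_rel X d `` {F}) (cauchy_rel X d `` {G}) q"
  then obtain F' G' where 1: "(F, F') \<in> cauchy_rel X d" "(G, G') \<in> cauchy_rel X d"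
      "cauchy_family_dist d F' G' q"
    by (auto simp: cauchy_dist_def)
  then have 2: "F' \<in> cauchy_families X d" "G' \<in> cauchy_families X d"
      "cauchy_family_dist d F F' 0" "cauchy_family_dist d G' G 0"
    by (auto simp: cauchy_rel_def intro: cauchy_family_dist_sym)
  have "cauchy_family_dist d F G' (0 + q)"
    by (rule cauchy_family_dist_trans[OF pm F 2(1,2) _ q 2(3) 1(3)]) simp
  from cauchy_family_dist_trans[OF pm F 2(2) G _ _ this 2(4)]
  have "cauchy_family_dist d F G (0 + q + 0)" using q by auto
  then show "cauchy_family_dist d F G q" by simp
next
  assume "cauchy_family_dist d F G q"
  moreover have "F \<in> cauchy_rel X d `` {F}" "G \<in> cauchy_rel X d `` {G}"
    using equiv_class_self[OF equiv_cauchy_rel[OF pm]] F G by auto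
  ultimately show "cauchy_dist d (cauchy_rel X d `` {F}) (cauchy_rel X d `` {G}) q"
    by (auto simp: cauchy_dist_def)
qed

lemma premetric_on_cauchy_completion:
  assumes pm: "premetric_on X d"
  shows "premetric_on (cauchy_completion X d) (cauchy_dist d)"
proof -
  let ?C = "cauchy_families X d" and ?c = "\<lambda>F. cauchy_rel X d `` {F}"
  note eq = equiv_cauchy_rel[OF pm]
  have comp: "cauchy_completion X d = ?c ` ?C"
    by (auto simp: cauchy_completion_def quotient_def)
  obtain x where "x \<in> X" using premetric_onD(1)[OF pm] by auto
  then have "d x x q" if "0 < q" for q
    using premetric_onD(2)[OF pm, of x x] premetric_onD(6)[OF pm, of x x 0 q] that by simp
  then have "{{x}} \<in> ?C"
    using \<open>x \<in> X\<close> by (simp add: cauchy_families_def diam_le_def)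
  then have ne: "?c ` ?C \<noteq> {}" by auto
  have zero: "cauchy_dist d (?c F) (?c G) 0 \<longleftrightarrow> ?c F = ?c G" if "F \<in> ?C" "G \<in> ?C" for F G
    using that cauchy_dist_class[OF pm that, of 0] eq_equiv_class_iff[OF eq that]
    by (auto simp: cauchy_rel_def)
  have sym: "cauchy_dist d (?c G) (?c F) q"
    if "F \<in> ?C" "G \<in> ?C" "0 \<le> q" "cauchy_dist d (?c F) (?c G) q" for F G q
    using that by (auto simp: cauchy_dist_def intro: cauchy_family_dist_sym)
  have tri: "cauchy_dist d (?c F) (?c G) (p + q)"
    if "F \<in> ?C" "G \<in> ?C" "H \<in> ?C" "0 \<le> p" "0 \<le> q"
      "cauchy_dist d (?c F) (?c H) p" "cauchy_dist d (?c H) (?c G) q" for F G H p q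
    using that by (auto simp: cauchy_dist_class[OF pm] intro: cauchy_family_dist_trans[OF pm])
  have lim: "cauchy_dist d (?c F) (?c G) p \<longleftrightarrow> (\<forall>q>p. cauchy_dist d (?c F) (?c G) q)"
    if "F \<in> ?C" "G \<in> ?C" "0 \<le> p" for F G p
  proof -
    have "cauchy_family_dist d F G p \<longleftrightarrow> (\<forall>q>p. cauchy_family_dist d F G q)"
    proof (intro iffI allI impI)
      fix q assume A: "cauchy_family_dist d F G p" "p < q"
      have "cauchy_family_dist d G G (q - p)"
        unfolding cauchy_family_dist_def
      proof (intro allI impI)
        fix e :: rat assume e: "0 < e"
        then have "\<exists>S\<in>G. diam_le d S e" using that(2) by (simp add: cauchy_families_def)
        then obtain S where S: "S \<in> G" "diam_le d S e" by blast
        then have "S \<subseteq> X" using that by (auto simp: cauchy_families_def)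
        then have "d x y (q - p + e)" if "x \<in> S" "y \<in> S" for x y
          using S A(2) e premetric_onD(6)[OF pm, of x y e "q - p + e"] that
          by (auto simp: diam_le_def)
        then have "diam_le d S (q - p + e)" by (simp add: diam_le_def)
        then show "\<exists>S\<in>G. \<exists>T\<in>G. diam_le d S e \<and> diam_le d T e \<and> diam_le d (S \<union> T) (q - p + e)"
          using S by (intro bexI[of _ S]) auto
      qed
      then show "cauchy_family_dist d F G q"
        using cauchy_family_dist_trans[OF pm that(1,2,2), of p "q - p"] A that(3) by simp
    next
      assume A: "\<forall>q>p. cauchy_family_dist d F G q"
      show "cauchy_family_dist d F G p"
        unfolding cauchy_family_dist_iff[OF pm that]
      proof (intro allI impI ballI)
        fix a b S T x y
        assume a: "0 < a" "0 < b" "S \<in> F" "T \<in> G" "diam_le d S a" "diam_le d T b" "x \<in> S" "y \<in> T"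
        have X: "S \<subseteq> X" "T \<subseteq> X" using that a by (auto simp: cauchy_families_def)
        show "d x y (a + p + b)"
        proof (rule premetric_onD(5)[OF pm])
          fix k assume k: "a + p + b < k"
          then have k': "p < k - a - b" by simp
          then have "cauchy_family_dist d F G (k - a - b)" using A by blast
          moreover have "0 \<le> k - a - b" using k' that(3) by simp
          ultimately have "d x y (a + (k - a - b) + b)"
            using cauchy_family_dist_iff[OF pm that(1,2)] a by blast
          then show "d x y k" by simp
        qed (use a X that in auto)
      qed
    qed
    then show ?thesis using that by (auto simp: cauchy_dist_class[OF pm])
  qed
  show ?thesis
    unfolding comp by (rule premetric_on_imageI) (fact ne zero sym tri lim)+
qed

lemma regular_familiesD:
  assumes "S \<in> regular_families X d" and "0 < q"
  shows "S q \<subseteq> X" and "\<exists>s. s \<in> S q \<and> s \<in> X"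
proof -
  show "S q \<subseteq> X" using assms by (auto simp: regular_families_def PiE_iff)
  moreover have "S q \<noteq> {}" using assms by (auto simp: regular_families_def)
  ultimately show "\<exists>s. s \<in> S q \<and> s \<in> X" by blast
qed

lemma regular_family_dist_iff:
  assumes pm: "premetric_on X d" and S: "S \<in> regular_families X d" and T: "T \<in> regular_families X d"
    and q: "0 \<le> q"
  shows "regular_family_dist d S T q \<longleftrightarrow>
    (\<forall>p>0. \<forall>r>0. \<forall>x\<in>S p. \<forall>y\<in>T r. d x y (p + q + r))" (is "?L \<longleftrightarrow> ?R")
proof
  assume L: ?L
  show ?R
  proof (intro allI impI ballI)
    fix p r x y
    assume a: "0 < p" "0 < r" "x \<in> S p" "y \<in> T r"
    have X: "x \<in> X" "y \<in> X" using regular_familiesD(1)[OF S] regular_familiesD(1)[OF T] a by auto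
    show "d x y (p + q + r)"
    proof (rule premetric_onD(5)[OF pm])
      fix k assume k: "p + q + r < k"
      then have "0 < k - (p + q + r)" by simp
      then obtain a' b' c s t where st: "0 < a'" "0 < b'" "0 < c" "s \<in> S a'" "t \<in> T b'"
          "a' + b' + c < q + (k - (p + q + r))" "d s t c"
        using L unfolding regular_family_dist_def by blast
      have X': "s \<in> X" "t \<in> X" using regular_familiesD(1)[OF S] regular_familiesD(1)[OF T] st by auto
      have 1: "d x s (p + a')" "d t y (b' + r)"
        using S T a st by (auto simp: regular_families_def)
      have "d x t ((p + a') + c)"
        by (rule premetric_onD(4)[OF pm _ _ _ _ _ 1(1) st(7)]) (use X X' a st in auto)
      from premetric_onD(4)[OF pm _ _ _ _ _ this 1(2)]
      have "d x y (((p + a') + c) + (b' + r))" using X X' a st by auto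
      from premetric_onD(6)[OF pm _ _ _ _ this] show "d x y k" using X a st by auto
    qed (use a X q in auto)
  qed
next
  assume R: ?R
  show ?L unfolding regular_family_dist_def
  proof (intro allI impI)
    fix e :: rat assume "0 < e"
    then have e: "0 < e / 5" by simp
    obtain s t where st: "s \<in> S (e/5)" "t \<in> T (e/5)"
      using regular_familiesD(2)[OF S e] regular_familiesD(2)[OF T e] by blast
    have "d s t (e/5 + q + e/5)" using R e st by blast
    moreover have "0 < e/5 + q + e/5" "e/5 + e/5 + (e/5 + q + e/5) < q + e" using e q by auto
    ultimately show "\<exists>a>0. \<exists>b>0. \<exists>c>0. \<exists>s\<in>S a. \<exists>t\<in>T b. a + b + c < q + e \<and> d s t c"
      using e st by blast
  qed
qed

lemma regular_rel_iff:
  assumes pm: "premetric_on X d"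
  shows "(S, T) \<in> regular_rel X d \<longleftrightarrow>
    S \<in> regular_families X d \<and> T \<in> regular_families X d \<and> regular_family_dist d S T 0"
  by (simp add: regular_rel_def regular_family_dist_iff[OF pm] cong: conj_cong)

lemma regular_family_dist_refl:
  assumes "premetric_on X d" and "S \<in> regular_families X d"
  shows "regular_family_dist d S S 0"
  using assms(2) unfolding regular_family_dist_iff[OF assms(1,2,2) order_refl]
  by (simp add: regular_families_def)

lemma regular_family_dist_sym:
  assumes pm: "premetric_on X d" and S: "S \<in> regular_families X d" and T: "T \<in> regular_families X d"
    and q: "0 \<le> q" and "regular_family_dist d S T q"
  shows "regular_family_dist d T S q"
  unfolding regular_family_dist_iff[OF pm T S q]
proof (intro allI impI ballI)
  fix p r x y assume a: "0 < p" "0 < r" "x \<in> T p" "y \<in> S r"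
  then have "d y x (r + q + p)"
    using assms(5) unfolding regular_family_dist_iff[OF pm S T q] by blast
  from premetric_onD(3)[OF pm _ _ _ this] have "d x y (r + q + p)"
    using a q regular_familiesD(1)[OF S, of r] regular_familiesD(1)[OF T, of p] by auto
  then show "d x y (p + q + r)" by (simp add: algebra_simps)
qed

lemma regular_family_dist_trans:
  assumes pm: "premetric_on X d"
    and S: "S \<in> regular_families X d" and T: "T \<in> regular_families X d" and U: "U \<in> regular_families X d"
    and pq: "0 \<le> p" "0 \<le> q"
    and ST: "regular_family_dist d S T p" and TU: "regular_family_dist d T U q"
  shows "regular_family_dist d S U (p + q)"
  unfolding regular_family_dist_iff[OF pm S U add_nonneg_nonneg[OF pq]]
proof (intro allI impI ballI)
  fix a b x y
  assume a: "0 < a" "0 < b" "x \<in> S a" "y \<in> U b"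
  have X: "x \<in> X" "y \<in> X" using regular_familiesD(1)[OF S] regular_familiesD(1)[OF U] a by auto
  show "d x y (a + (p + q) + b)"
  proof (rule premetric_onD(5)[OF pm])
    fix k assume k: "a + (p + q) + b < k"
    define e where "e = (k - (a + (p + q) + b)) / 2"
    have e: "0 < e" using k by (simp add: e_def)
    obtain u where u: "u \<in> T e" "u \<in> X" using regular_familiesD(2)[OF T e] by blast
    have 1: "d x u (a + p + e)"
      using ST a u e unfolding regular_family_dist_iff[OF pm S T pq(1)] by blast
    have 2: "d u y (e + q + b)"
      using TU a u e unfolding regular_family_dist_iff[OF pm T U pq(2)] by blast
    have "d x y ((a + p + e) + (e + q + b))"
      by (rule premetric_onD(4)[OF pm _ _ _ _ _ 1 2]) (use a u X pq e in auto)
    then show "d x y k" by (simp add: e_def field_simps)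
  qed (use a X pq in auto)
qed

lemma equiv_regular_rel:
  assumes pm: "premetric_on X d"
  shows "equiv (regular_families X d) (regular_rel X d)"
proof (rule equivI)
  show "regular_rel X d \<subseteq> regular_families X d \<times> regular_families X d"
    by (auto simp: regular_rel_def)
  show "refl_on (regular_families X d) (regular_rel X d)"
    by (auto simp: refl_on_def regular_rel_iff[OF pm] intro: regular_family_dist_refl[OF pm])
  show "sym (regular_rel X d)"
    by (auto simp: sym_def regular_rel_iff[OF pm] intro: regular_family_dist_sym[OF pm])
  show "trans (regular_rel X d)"
    by (auto simp: trans_def regular_rel_iff[OF pm]
        dest: regular_family_dist_trans[OF pm, where p = 0 and q = 0])
qed

lemma richman_dist_class:
  assumes pm: "premetric_on X d" and S: "S \<in> regular_families X d" and T: "T \<in> regular_families X d"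
    and q: "0 \<le> q"
  shows "richman_dist d (regular_rel X d `` {S}) (regular_rel X d `` {T}) q \<longleftrightarrow> regular_family_dist d S T q"
proof
  assume "richman_dist d (regular_rel X d `` {S}) (regular_rel X d `` {T}) q"
  then obtain S' T' where 1: "(S, S') \<in> regular_rel X d" "(T, T') \<in> regular_rel X d"
      "regular_family_dist d S' T' q"
    by (auto simp: richman_dist_def)
  then have 2: "S' \<in> regular_families X d" "T' \<in> regular_families X d"
      "regular_family_dist d S S' 0" "regular_family_dist d T' T 0"
    by (auto simp: regular_rel_iff[OF pm] intro: regular_family_dist_sym[OF pm])
  have "regular_family_dist d S T' (0 + q)"
    by (rule regular_family_dist_trans[OF pm S 2(1,2) _ q 2(3) 1(3)]) simp
  from regular_family_dist_trans[OF pm S 2(2) T _ _ this 2(4)]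
  have "regular_family_dist d S T (0 + q + 0)" using q by auto
  then show "regular_family_dist d S T q" by simp
next
  assume "regular_family_dist d S T q"
  moreover have "S \<in> regular_rel X d `` {S}" "T \<in> regular_rel X d `` {T}"
    using equiv_class_self[OF equiv_regular_rel[OF pm]] S T by auto
  ultimately show "richman_dist d (regular_rel X d `` {S}) (regular_rel X d `` {T}) q"
    by (auto simp: richman_dist_def)
qed

lemma constant_regular_family:
  assumes pm: "premetric_on X d" and x: "x \<in> X"
  shows "(\<lambda>q\<in>{0<..}. {x}) \<in> regular_families X d"
  using x premetric_onD(2)[OF pm x x] premetric_onD(6)[OF pm x x, of 0]
  by (auto simp: regular_families_def)

lemma premetric_on_richman_completion:
  assumes pm: "premetric_on X d"
  shows "premetric_on (richman_completion X d) (richman_dist d)"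
proof -
  let ?C = "regular_families X d" and ?c = "\<lambda>S. regular_rel X d `` {S}"
  note eq = equiv_regular_rel[OF pm]
  have comp: "richman_completion X d = ?c ` ?C"
    by (auto simp: richman_completion_def quotient_def)
  have ne: "?c ` ?C \<noteq> {}"
    using constant_regular_family[OF pm] premetric_onD(1)[OF pm] by blast
  have zero: "richman_dist d (?c S) (?c T) 0 \<longleftrightarrow> ?c S = ?c T" if "S \<in> ?C" "T \<in> ?C" for S T
    using that richman_dist_class[OF pm that, of 0] eq_equiv_class_iff[OF eq that]
    by (auto simp: regular_rel_iff[OF pm])
  have sym: "richman_dist d (?c T) (?c S) q"
    if "S \<in> ?C" "T \<in> ?C" "0 \<le> q" "richman_dist d (?c S) (?c T) q" for S T q
    using that by (auto simp: richman_dist_class[OF pm] intro: regular_family_dist_sym[OF pm])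
  have tri: "richman_dist d (?c S) (?c T) (p + q)"
    if "S \<in> ?C" "T \<in> ?C" "U \<in> ?C" "0 \<le> p" "0 \<le> q"
      "richman_dist d (?c S) (?c U) p" "richman_dist d (?c U) (?c T) q" for S T U p q
    using that by (auto simp: richman_dist_class[OF pm] intro: regular_family_dist_trans[OF pm])
  have lim: "richman_dist d (?c S) (?c T) p \<longleftrightarrow> (\<forall>q>p. richman_dist d (?c S) (?c T) q)"
    if "S \<in> ?C" "T \<in> ?C" "0 \<le> p" for S T p
  proof -
    have "regular_family_dist d S T p \<longleftrightarrow> (\<forall>q>p. regular_family_dist d S T q)"
    proof (intro iffI allI impI)
      fix q assume "regular_family_dist d S T p" "p < q"
      then show "regular_family_dist d S T q"
        unfolding regular_family_dist_def by (meson add_strict_right_mono less_trans)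
    next
      assume A: "\<forall>q>p. regular_family_dist d S T q"
      show "regular_family_dist d S T p"
        unfolding regular_family_dist_def
      proof (intro allI impI)
        fix e :: rat assume "0 < e"
        then have "regular_family_dist d S T (p + e/2)" "0 < e / 2" using A by auto
        then have "\<exists>a>0. \<exists>b>0. \<exists>c>0. \<exists>s\<in>S a. \<exists>t\<in>T b. a + b + c < p + e/2 + e/2 \<and> d s t c"
          unfolding regular_family_dist_def by blast
        then show "\<exists>a>0. \<exists>b>0. \<exists>c>0. \<exists>s\<in>S a. \<exists>t\<in>T b. a + b + c < p + e \<and> d s t c"
          by (simp add: add.commute)
      qed
    qed
    then show ?thesis using that by (auto simp: richman_dist_class[OF pm])
  qed
  show ?thesis
    unfolding comp by (rule premetric_on_imageI) (fact ne zero sym tri lim)+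
qed

end

theory Submission
  imports Defs
begin

text \<open>
  A regular family \<open>S\<close> yields the Cauchy family of the sets \<open>\<Union>p\<le>r. S p\<close>, and a Cauchy family \<open>F\<close>
  yields the regular family whose \<open>q\<close>-th member is the union of all members of \<open>F\<close> of diameter at
  most \<open>q\<close>. The first assignment preserves distances, and the second inverts it up to equivalence.
  A regular family \<open>\<S>\<close> in the Richman completion is the image of the class of the regular family in
  \<open>X\<close> whose \<open>q\<close>-th member collects the points of \<open>S (q/2)\<close> for all \<open>S\<close> that represent an element
  of \<open>\<S> (q/2)\<close>.
\<close>

section \<open>Passing between regular families and Cauchy families\<close>

definition tail_union :: "(rat \<Rightarrow> 'a set) \<Rightarrow> rat \<Rightarrow> 'a set" where
  "tail_union S r = (\<Union>p\<in>{0<..r}. S p)"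

text \<open>The members \<open>S p\<close> of a regular family may be pairwise disjoint, so they
  need not form a Cauchy family. The tail unions increase with the index and therefore meet.\<close>

definition cauchy_of_regular :: "(rat \<Rightarrow> 'a set) \<Rightarrow> 'a set set" where
  "cauchy_of_regular S = tail_union S ` {0<..}"

text \<open>Taking all members of small diameter avoids choosing one. Points of two of them are
  linked through a common point, which costs exactly the sum of indices that regularity
  allows.\<close>

definition regular_of_cauchy ::
  "('a \<Rightarrow> 'a \<Rightarrow> rat \<Rightarrow> bool) \<Rightarrow> 'a set set \<Rightarrow> rat \<Rightarrow> 'a set" where
  "regular_of_cauchy d F = (\<lambda>q\<in>{0<..}. \<Union>{A\<in>F. diam_le d A q})"

lemma tail_union_subset:
  assumes "S \<in> regular_families X d"
  shows "tail_union S r \<subseteq> X"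
  using regular_familiesD(1)[OF assms] by (fastforce simp: tail_union_def)

lemma family_subset_tail_union: "0 < p \<Longrightarrow> p \<le> r \<Longrightarrow> S p \<subseteq> tail_union S r"
  by (auto simp: tail_union_def)

text \<open>The two points carry indices \<open>p\<close> and \<open>p'\<close> of size at most
  \<open>r\<close>, so the bound \<open>p + q + p'\<close> is at most \<open>q + 2 * r\<close>. The
  case \<open>S = T\<close>, \<open>q = 0\<close> bounds the diameter of a tail union.\<close>

lemma tail_union_dist:
  assumes pm: "premetric_on X d" and S: "S \<in> regular_families X d" and T: "T \<in> regular_families X d"
    and q: "0 \<le> q" and "regular_family_dist d S T q"
    and "x \<in> tail_union S r" and "y \<in> tail_union T r"
  shows "d x y (q + 2 * r)"
proof -
  obtain p p' where p: "0 < p" "p \<le> r" "x \<in> S p" "0 < p'" "p' \<le> r" "y \<in> T p'"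
    using assms(6,7) by (auto simp: tail_union_def)
  have "d x y (p + q + p')"
    using assms(5) p unfolding regular_family_dist_iff[OF pm S T q] by blast
  then show ?thesis
    by (rule premetric_onD(6)[OF pm, rotated 4])
      (use p q regular_familiesD(1)[OF S p(1)] regular_familiesD(1)[OF T p(4)] in auto)
qed

lemma diam_le_tail_union:
  assumes "premetric_on X d" and "S \<in> regular_families X d"
  shows "diam_le d (tail_union S r) (2 * r)"
  using tail_union_dist[OF assms(1,2,2) order_refl regular_family_dist_refl[OF assms]]
  by (simp add: diam_le_def)

text \<open>Two tail unions meet because both contain the nonempty set \<open>S (min r r')\<close>.
  Diameter \<open>e\<close> is reached at index \<open>e/2\<close>.\<close>

lemma cauchy_of_regular_in_cauchy_families:
  assumes pm: "premetric_on X d" and S: "S \<in> regular_families X d"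
  shows "cauchy_of_regular S \<in> cauchy_families X d"
proof -
  have "tail_union S r \<inter> tail_union S r' \<noteq> {}" if "0 < r" "0 < r'" for r r'
  proof -
    have "0 < min r r'" using that by simp
    then show ?thesis
      using regular_familiesD(2)[OF S, of "min r r'"] family_subset_tail_union[of "min r r'" _ S]
      by (meson disjoint_iff min.cobounded1 min.cobounded2 subsetD)
  qed
  moreover have "\<exists>r>0. diam_le d (tail_union S r) e" if "0 < e" for e
    using diam_le_tail_union[OF pm S, of "e/2"] that by (intro exI[of _ "e/2"]) simp
  ultimately show ?thesis
    using tail_union_subset[OF S] unfolding cauchy_families_def cauchy_of_regular_def
    by (simp add: image_subset_iff Bex_def)
qed

text \<open>Equivalence is distance 0 on both sides, so this makes the assignment well defined and
  injective on classes as well as distance preserving.\<close>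

lemma cauchy_family_dist_cauchy_of_regular:
  assumes pm: "premetric_on X d" and S: "S \<in> regular_families X d" and T: "T \<in> regular_families X d"
    and q: "0 \<le> q"
  shows "cauchy_family_dist d (cauchy_of_regular S) (cauchy_of_regular T) q
    \<longleftrightarrow> regular_family_dist d S T q"
proof
  assume R: "regular_family_dist d S T q"
  show "cauchy_family_dist d (cauchy_of_regular S) (cauchy_of_regular T) q"
    unfolding cauchy_family_dist_def
  proof (intro allI impI)
    fix e :: rat assume e: "0 < e"
    let ?A = "tail_union S (e/2)" and ?B = "tail_union T (e/2)"
    have diam: "diam_le d ?A e" "diam_le d ?B e"
      using diam_le_tail_union[OF pm S, of "e/2"] diam_le_tail_union[OF pm T, of "e/2"] by auto
    have sub: "?A \<subseteq> X" "?B \<subseteq> X" using tail_union_subset S T by blast+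
    \<comment> \<open>The diameter of a union ranges over ordered pairs, so the mixed distances are
      needed in both directions.\<close>
    have cross: "d x y (q + e)" "d y x (q + e)" if "x \<in> ?A" "y \<in> ?B" for x y
    proof -
      show "d x y (q + e)" using tail_union_dist[OF pm S T q R that] by simp
      then show "d y x (q + e)"
        by (rule premetric_onD(3)[OF pm, rotated 3]) (use that sub q e in auto)
    qed
    have mono: "d x y (q + e)" if "d x y e" "x \<in> X" "y \<in> X" for x y
      by (rule premetric_onD(6)[OF pm that(2,3) _ _ that(1)]) (use q e in auto)
    have "diam_le d (?A \<union> ?B) (q + e)"
      using diam sub cross mono unfolding diam_le_def by blast
    moreover have "?A \<in> cauchy_of_regular S" "?B \<in> cauchy_of_regular T"
      using e by (auto simp: cauchy_of_regular_def)
    ultimately show "\<exists>A\<in>cauchy_of_regular S. \<exists>B\<in>cauchy_of_regular T.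
        diam_le d A e \<and> diam_le d B e \<and> diam_le d (A \<union> B) (q + e)"
      using diam by blast
  qed
next
  assume C: "cauchy_family_dist d (cauchy_of_regular S) (cauchy_of_regular T) q"
  show "regular_family_dist d S T q"
    unfolding regular_family_dist_def
  proof (intro allI impI)
    fix e :: rat assume "0 < e"
    \<comment> \<open>Two quarters bound the indices and one goes to the distance; the fourth keeps
      the final inequality strict.\<close>
    then have e: "0 < e / 4" by simp
    then obtain r r' where r: "0 < r" "0 < r'"
        "diam_le d (tail_union S r \<union> tail_union T r') (q + e/4)"
      using C unfolding cauchy_family_dist_def cauchy_of_regular_def by blast
    \<comment> \<open>A small diameter of \<open>tail_union S r\<close> does not make \<open>r\<close> small, hence the smaller indices.\<close>
    let ?a = "min r (e/4)" and ?b = "min r' (e/4)"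
    have ab: "0 < ?a" "0 < ?b" using r e by auto
    obtain s t where st: "s \<in> S ?a" "t \<in> T ?b"
      using regular_familiesD(2)[OF S ab(1)] regular_familiesD(2)[OF T ab(2)] by blast
    have "s \<in> tail_union S r" "t \<in> tail_union T r'"
      using st ab family_subset_tail_union[of ?a r S] family_subset_tail_union[of ?b r' T] by auto
    then have "d s t (q + e/4)" using r(3) by (auto simp: diam_le_def)
    moreover have "?a \<le> e/4" "?b \<le> e/4" by simp_all
    then have "?a + ?b + (q + e/4) < q + e" using e by linarith
    moreover have "0 < q + e/4" using q e by linarith
    ultimately show "\<exists>a>0. \<exists>b>0. \<exists>c>0. \<exists>s\<in>S a. \<exists>t\<in>T b. a + b + c < q + e \<and> d s t c"
      using ab st by blast
  qed
qed

text \<open>Any two members of \<open>F\<close> share a point \<open>z\<close>, and the triangle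
  inequality through \<open>z\<close> adds their diameters.\<close>

lemma regular_of_cauchy_in_regular_families:
  assumes pm: "premetric_on X d" and F: "F \<in> cauchy_families X d"
  shows "regular_of_cauchy d F \<in> regular_families X d"
proof -
  have sub: "A \<subseteq> X" if "A \<in> F" for A using F that by (auto simp: cauchy_families_def)
  have meet: "A \<inter> B \<noteq> {}" if "A \<in> F" "B \<in> F" for A B
    using F that by (auto simp: cauchy_families_def)
  have small: "\<exists>A\<in>F. diam_le d A q" if "0 < q" for q
    using F that by (auto simp: cauchy_families_def)
  have "d x y (p + q)"
    if "0 < p" "0 < q" "A \<in> F" "diam_le d A p" "x \<in> A" "B \<in> F" "diam_le d B q" "y \<in> B" for p q A B x y
  proof -
    obtain z where z: "z \<in> A" "z \<in> B" using meet \<open>A \<in> F\<close> \<open>B \<in> F\<close> by blast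
    have "d x z p" "d z y q" using that z by (auto simp: diam_le_def)
    then show ?thesis
      by (rule premetric_onD(4)[OF pm, rotated 5]) (use that z sub in auto)
  qed
  \<comment> \<open>Members of \<open>F\<close> are nonempty because each meets itself.\<close>
  moreover have "\<exists>x. \<exists>A\<in>F. diam_le d A q \<and> x \<in> A" if "0 < q" for q
    using small[OF that] meet by blast
  then have "regular_of_cauchy d F q \<noteq> {}" if "0 < q" for q
    using that by (auto simp: regular_of_cauchy_def)
  moreover have "regular_of_cauchy d F \<in> {0<..} \<rightarrow>\<^sub>E Pow X"
    using sub by (auto simp: regular_of_cauchy_def)
  ultimately show ?thesis
    by (auto simp: regular_families_def regular_of_cauchy_def)
qed

text \<open>A member \<open>A\<close> of \<open>F\<close> of diameter at most \<open>e/2\<close> is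
  contained in the tail union at \<open>e/2\<close>, so the diameter bound \<open>e\<close> of that
  tail union also covers \<open>A\<close> and the union of the two.\<close>

lemma cauchy_of_regular_of_cauchy:
  assumes pm: "premetric_on X d" and F: "F \<in> cauchy_families X d"
  shows "(cauchy_of_regular (regular_of_cauchy d F), F) \<in> cauchy_rel X d"
proof -
  let ?S = "regular_of_cauchy d F"
  note S = regular_of_cauchy_in_regular_families[OF assms]
  have "cauchy_family_dist d (cauchy_of_regular ?S) F 0"
    unfolding cauchy_family_dist_def
  proof (intro allI impI)
    fix e :: rat assume e: "0 < e"
    then have "\<exists>A\<in>F. diam_le d A (e/2)" using F by (simp add: cauchy_families_def)
    then obtain A where A: "A \<in> F" "diam_le d A (e/2)" by blast
    let ?U = "tail_union ?S (e/2)"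
    have "A \<subseteq> ?S (e/2)" using A e by (auto simp: regular_of_cauchy_def)
    then have AU: "A \<subseteq> ?U" using family_subset_tail_union[of "e/2" "e/2" ?S] e by auto
    have U: "diam_le d ?U e" using diam_le_tail_union[OF pm S, of "e/2"] by simp
    have "diam_le d A e" using U AU by (auto simp: diam_le_def)
    moreover have "?U \<union> A = ?U" using AU by blast
    moreover have "?U \<in> cauchy_of_regular ?S" using e by (auto simp: cauchy_of_regular_def)
    ultimately show "\<exists>U\<in>cauchy_of_regular ?S. \<exists>A\<in>F.
        diam_le d U e \<and> diam_le d A e \<and> diam_le d (U \<union> A) (0 + e)"
      using A(1) U by (metis add_0)
  qed
  then show ?thesis
    using F cauchy_of_regular_in_cauchy_families[OF pm S] by (simp add: cauchy_rel_def)
qed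

section \<open>The isometry between the two completions\<close>

theorem richman_completion_isometric_cauchy_completion:
  assumes pm: "premetric_on X d"
  shows "\<exists>\<phi>. premetric_isometry (richman_completion X d) (richman_dist d)
                (cauchy_completion X d) (cauchy_dist d) \<phi>"
proof -
  let ?c = "\<lambda>S. regular_rel X d `` {S}" and ?k = "\<lambda>F. cauchy_rel X d `` {F}"
  \<comment> \<open>A chosen representative turns the assignment on families into a map on classes;
    preservation of distances makes the choice immaterial.\<close>
  define rep where "rep C = (SOME S. S \<in> regular_families X d \<and> ?c S = C)" for C
  define \<phi> where "\<phi> C = ?k (cauchy_of_regular (rep C))" for C
  have rep: "rep C \<in> regular_families X d" "?c (rep C) = C" if "C \<in> richman_completion X d" for C
  proof -
    have "\<exists>S. S \<in> regular_families X d \<and> ?c S = C"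
      using that by (auto simp: richman_completion_def quotient_def)
    from someI_ex[OF this] show "rep C \<in> regular_families X d" "?c (rep C) = C"
      by (simp_all add: rep_def)
  qed
  have dist: "cauchy_dist d (\<phi> C) (\<phi> D) q \<longleftrightarrow> richman_dist d C D q"
    if "C \<in> richman_completion X d" "D \<in> richman_completion X d" "0 \<le> q" for C D q
    using cauchy_dist_class[OF pm cauchy_of_regular_in_cauchy_families[OF pm rep(1)[OF that(1)]]
        cauchy_of_regular_in_cauchy_families[OF pm rep(1)[OF that(2)]] that(3)]
      cauchy_family_dist_cauchy_of_regular[OF pm rep(1)[OF that(1)] rep(1)[OF that(2)] that(3)]
      richman_dist_class[OF pm rep(1)[OF that(1)] rep(1)[OF that(2)] that(3)]
      rep(2)[OF that(1)] rep(2)[OF that(2)]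
    by (simp add: \<phi>_def)
  have into: "\<phi> C \<in> cauchy_completion X d" if "C \<in> richman_completion X d" for C
    using cauchy_of_regular_in_cauchy_families[OF pm rep(1)[OF that]]
    by (auto simp: \<phi>_def cauchy_completion_def intro: quotientI)
  have onto: "\<exists>C\<in>richman_completion X d. \<phi> C = D" if "D \<in> cauchy_completion X d" for D
  proof -
    obtain F where F: "F \<in> cauchy_families X d" "D = ?k F"
      using \<open>D \<in> cauchy_completion X d\<close> by (auto simp: cauchy_completion_def quotient_def)
    let ?S = "regular_of_cauchy d F"
    note S = regular_of_cauchy_in_regular_families[OF pm F(1)]
    have C: "?c ?S \<in> richman_completion X d"
      using S by (auto simp: richman_completion_def intro: quotientI)
    note R = rep[OF C]
    \<comment> \<open>\<open>rep\<close> may return a family other than \<open>?S\<close>. The two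
      are equivalent, and preservation of distance 0 carries this over to their Cauchy families, the
      second of which is equivalent to \<open>F\<close>.\<close>
    have "(rep (?c ?S), ?S) \<in> regular_rel X d"
      using eq_equiv_class_iff[OF equiv_regular_rel[OF pm] R(1) S] R(2) by simp
    then have "cauchy_family_dist d (cauchy_of_regular (rep (?c ?S))) (cauchy_of_regular ?S) 0"
      using cauchy_family_dist_cauchy_of_regular[OF pm R(1) S order_refl] regular_rel_iff[OF pm]
      by blast
    then have "(cauchy_of_regular (rep (?c ?S)), cauchy_of_regular ?S) \<in> cauchy_rel X d"
      using cauchy_of_regular_in_cauchy_families[OF pm] R(1) S by (simp add: cauchy_rel_def)
    then have "\<phi> (?c ?S) = D"
      using equiv_class_eq[OF equiv_cauchy_rel[OF pm]] cauchy_of_regular_of_cauchy[OF pm F(1)] F(2)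
      by (simp add: \<phi>_def)
    then show ?thesis using C by blast
  qed
  have "premetric_isometry (richman_completion X d) (richman_dist d)
      (cauchy_completion X d) (cauchy_dist d) \<phi>"
    unfolding premetric_isometry_def isometric_embedding_def using dist into onto by blast
  then show ?thesis by blast
qed

section \<open>Completeness of the Richman completion\<close>

definition diagonal_family ::
  "'a set \<Rightarrow> ('a \<Rightarrow> 'a \<Rightarrow> rat \<Rightarrow> bool) \<Rightarrow> (rat \<Rightarrow> (rat \<Rightarrow> 'a set) set set) \<Rightarrow> rat \<Rightarrow> 'a set" where
  "diagonal_family X d \<S> =
     (\<lambda>q\<in>{0<..}. {x. \<exists>S\<in>regular_families X d. regular_rel X d `` {S} \<in> \<S> (q/2) \<and> x \<in> S (q/2)})"

text \<open>One half of \<open>a\<close> is the index in \<open>\<S>\<close>, the other the index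
  inside a representative \<open>S\<close>. Regularity of \<open>\<S>\<close> puts the classes of
  \<open>S\<close> and \<open>T\<close> within \<open>a/2 + p\<close>, and the indices
  \<open>a/2\<close> and \<open>b\<close> of the two points are added to this. The bound serves both
  for the regularity of the diagonal family and for its distance to \<open>\<S>\<close>.\<close>

lemma diagonal_family_dist:
  assumes pm: "premetric_on X d"
    and \<S>: "\<S> \<in> regular_families (richman_completion X d) (richman_dist d)"
    and x: "x \<in> diagonal_family X d \<S> a" and T: "T \<in> regular_families X d"
    and Tp: "regular_rel X d `` {T} \<in> \<S> p" and y: "y \<in> T b"
    and pos: "0 < a" "0 < p" "0 < b"
  shows "d x y (a + p + b)"
proof -
  obtain S where S: "S \<in> regular_families X d" "regular_rel X d `` {S} \<in> \<S> (a/2)" "x \<in> S (a/2)"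
    using x pos by (auto simp: diagonal_family_def)
  have a2: "0 < a / 2" using pos by simp
  then have "richman_dist d (regular_rel X d `` {S}) (regular_rel X d `` {T}) (a/2 + p)"
    using \<S> S(2) Tp pos unfolding regular_families_def by blast
  moreover have nn: "0 \<le> a/2 + p" using pos by simp
  ultimately have "regular_family_dist d S T (a/2 + p)"
    using richman_dist_class[OF pm S(1) T] by blast
  then have "d x y (a/2 + (a/2 + p) + b)"
    using S(3) y pos a2 unfolding regular_family_dist_iff[OF pm S(1) T nn] by blast
  then show ?thesis by (simp flip: add.assoc)
qed

lemma richman_completion_rep:
  assumes "\<S> \<in> regular_families (richman_completion X d) (richman_dist d)" and "0 < q" and "C \<in> \<S> q"
  obtains S where "S \<in> regular_families X d" "C = regular_rel X d `` {S}"
  using regular_familiesD(1)[OF assms(1,2)] assms(3)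
  by (auto simp: richman_completion_def quotient_def)

lemma diagonal_family_in_regular_families:
  assumes pm: "premetric_on X d"
    and \<S>: "\<S> \<in> regular_families (richman_completion X d) (richman_dist d)"
  shows "diagonal_family X d \<S> \<in> regular_families X d"
proof -
  let ?T = "diagonal_family X d \<S>"
  have "?T q \<subseteq> X" if "0 < q" for q
    using that regular_familiesD(1)[of _ X d "q/2"] by (auto simp: diagonal_family_def)
  moreover have "?T q \<noteq> {}" if "0 < q" for q
  proof -
    have q2: "0 < q / 2" using that by simp
    obtain C where C: "C \<in> \<S> (q/2)" using regular_familiesD(2)[OF \<S> q2] by blast
    obtain S where S: "S \<in> regular_families X d" "C = regular_rel X d `` {S}"
      using richman_completion_rep[OF \<S> q2 C] .
    obtain x where "x \<in> S (q/2)" using regular_familiesD(2)[OF S(1) q2] by blast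
    then show ?thesis using C S that by (auto simp: diagonal_family_def)
  qed
  moreover have "d x y (p + q)" if "0 < p" "0 < q" "x \<in> ?T p" "y \<in> ?T q" for p q x y
  proof -
    obtain S where "S \<in> regular_families X d" "regular_rel X d `` {S} \<in> \<S> (q/2)" "y \<in> S (q/2)"
      using \<open>y \<in> ?T q\<close> \<open>0 < q\<close> by (auto simp: diagonal_family_def)
    \<comment> \<open>Here the index in \<open>\<S>\<close> and the index inside the representative
      of \<open>y\<close> are both \<open>q/2\<close>.\<close>
    from diagonal_family_dist[OF pm \<S> that(3) this] that(1,2) have "d x y (p + q/2 + q/2)" by simp
    then show ?thesis by (simp add: add.assoc)
  qed
  moreover have "?T \<in> extensional {0<..}" by (simp add: diagonal_family_def)
  ultimately show ?thesis by (auto simp: regular_families_def PiE_iff)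
qed

theorem R_complete_richman_completion:
  assumes pm: "premetric_on X d"
  shows "R_complete (richman_completion X d) (richman_dist d)"
proof -
  let ?Y = "richman_completion X d" and ?dY = "richman_dist d"
  note pmY = premetric_on_richman_completion[OF pm]
  have "richman_map ?Y ?dY C \<in> richman_completion ?Y ?dY" if "C \<in> ?Y" for C
    using constant_regular_family[OF pmY that]
    unfolding richman_map_def richman_completion_def[of ?Y] by (rule quotientI)
  moreover have "Z \<in> richman_map ?Y ?dY ` ?Y" if Z: "Z \<in> richman_completion ?Y ?dY" for Z
  proof -
    obtain \<S> where \<S>: "\<S> \<in> regular_families ?Y ?dY" "Z = regular_rel ?Y ?dY `` {\<S>}"
      using Z unfolding richman_completion_def[of ?Y] by (rule quotientE)
    let ?T = "diagonal_family X d \<S>"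
    let ?C = "regular_rel X d `` {?T}"
    note T = diagonal_family_in_regular_families[OF pm \<S>(1)]
    have C: "?C \<in> ?Y" unfolding richman_completion_def using T by (rule quotientI)
    \<comment> \<open>The diagonal bound has the form \<open>a + q + b\<close>, which is the
      criterion for distance at most \<open>q\<close>. The index \<open>p\<close> of the constant
      family then enters by monotonicity alone.\<close>
    have "?dY ?C D (p + q)" if pos: "0 < p" "0 < q" and D: "D \<in> \<S> q" for p q D
    proof -
      obtain S where S: "S \<in> regular_families X d" "D = regular_rel X d `` {S}"
        using richman_completion_rep[OF \<S>(1) pos(2) D] .
      have "regular_family_dist d ?T S q"
        unfolding regular_family_dist_iff[OF pm T S(1) less_imp_le[OF pos(2)]]
        using diagonal_family_dist[OF pm \<S>(1) _ S(1)] pos D S(2) by blast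
      then have "?dY ?C D q" using richman_dist_class[OF pm T S(1)] pos D S(2) by simp
      then show ?thesis
        by (rule premetric_onD(6)[OF pmY, rotated 4])
          (use C pos D regular_familiesD(1)[OF \<S>(1) pos(2)] in auto)
    qed
    then have "((\<lambda>q\<in>{0<..}. {?C}), \<S>) \<in> regular_rel ?Y ?dY"
      using constant_regular_family[OF pmY C] \<S>(1) by (auto simp: regular_rel_def)
    then have "richman_map ?Y ?dY ?C = Z"
      using equiv_class_eq[OF equiv_regular_rel[OF pmY]] \<S>(2) by (simp add: richman_map_def)
    then show ?thesis using C by blast
  qed
  ultimately show ?thesis unfolding R_complete_def by blast
qed

theorem theorem3p5:
  fixes X :: "'a set" and d :: "'a \<Rightarrow> 'a \<Rightarrow> rat \<Rightarrow> bool"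
  assumes "premetric_on X d"
  shows "(\<exists>\<phi>. premetric_isometry (richman_completion X d) (richman_dist d)
                 (cauchy_completion X d) (cauchy_dist d) \<phi>) \<and>
         R_complete (richman_completion X d) (richman_dist d)"
  using richman_completion_isometric_cauchy_completion[OF assms]
    R_complete_richman_completion[OF assms] by blast

end
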